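(* Let $f_1,\dots,f_n:\mathbb{R}^d\to\mathbb{R}$ be functions and $f=\frac1n\sum_{i=1}^n f_i$. Assume: (i) each $f_i$ is differentiable and bounded from below; (ii) there exists $x\in\mathbb{R}^d$ with $\nabla f_i(x)=0$ for all $i\in\{1,\dots,n\}$; (iii) each $f_i$ is convex; (iv) each $f_i$ is $L_i$-smooth with $L_i>0$, and $L_{\max}=\max_i L_i$; (v) $f$ is $\mu$-strongly convex with $\mu>0$. Let $\gamma>0$, $\varepsilon_1\ge 0$, $x_0\in\mathbb{R}^d$, and let $\alpha$ satisfy $0<\alpha\le \frac14\cdot\frac{1}{\gamma L_\gamma}$, where $L_\gamma$ is the smoothness constant of $M^\gamma$. Let the iterates be generated by $$x_{k+1}=x_k+\alpha\left(\frac1n\sum_{i=1}^n\tilde x_{i,k+1}-x_k\right),\qquad k=0,1,2,\dots,$$ where for every $k$ and every $i$ the point $\tilde x_{i,k+1}\in\mathbb{R}^d$ satisfies $\|\tilde x_{i,k+1}-\mathrm{prox}_{\gamma f_i}(x_k)\|^2\le\varepsilon_1$. Then for every $K\geq 0$, $$\mathcal{E}_K\le\left(1-\frac{\alpha\gamma\mu}{8(1+\gamma L_{\max})}\right)^K\mathcal{E}_0+\frac{4\varepsilon_1(1+\gamma L_{\max})}{\mu}\left(2\alpha L_\gamma+\frac1\gamma\right),$$ where $\mathcal{E}_k=\gamma M^\gamma(x_k)-\gamma\inf M^\gamma$. In particular, if $\alpha=\frac14\cdot\frac{1}{\gamma L_\gamma}$, then $$\Delta_K\le\left(1-\frac{\mu}{32L_\gamma(1+\gamma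 L_{\max})}\right)^K\frac{L_\gamma(1+\gamma L_{\max})}{\mu}\,\Delta_0+12\,\varepsilon_1\left(\frac{1/\gamma+L_{\max}}{\mu}\right)^2,$$ where $\Delta_k=\|x_k-x_\star\|^2$ and $x_\star$ is a minimizer of $f$.
   Context: $\|\cdot\|$ is the Euclidean norm. $\phi$ is $L$-smooth if $\phi(x)-\phi(y)-\langle\nabla\phi(y),x-y\rangle\le\frac L2\|x-y\|^2$ for all $x,y\in\mathbb{R}^d$; $f$ is $\mu$-strongly convex if $f(x)-f(y)-\langle\nabla f(y),x-y\rangle\ge\frac\mu2\|x-y\|^2$ for all $x,y$. For convex $\phi:\mathbb{R}^d\to\mathbb{R}$ and $\gamma>0$, the proximal operator is $\mathrm{prox}_{\gamma\phi}(x)=\arg\min_{z}\{\phi(z)+\frac1{2\gamma}\|z-x\|^2\}$ and the Moreau envelope is $M^\gamma_\phi(x)=\min_z\{\phi(z)+\frac1{2\gamma}\|z-x\|^2\}$. Set $M^\gamma(x)=\frac1n\sum_{i=1}^n M^\gamma_{f_i}(x)$; this function is convex and smooth, and $L_\gamma$ denotes its smoothness constant (the smallest $L$ for which $M^\gamma$ is $L$-smooth). The iteration is the inexact FedExProx algorithm with constant extrapolation parameter $\alpha$. *)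

theory Defs
  imports "HOL-Analysis.Analysis"
begin

definition grad :: "('a::real_inner \<Rightarrow> real) \<Rightarrow> 'a \<Rightarrow> 'a" where
  "grad \<phi> x = (THE g. GDERIV \<phi> x :> g)"

text \<open>
  Differentiability is part of the next two notions because their inequalities mention the
  gradient. Smoothness is one-sided: only the upper quadratic bound is required.
\<close>

definition smooth :: "real \<Rightarrow> ('a::real_inner \<Rightarrow> real) \<Rightarrow> bool" where
  "smooth L \<phi> \<longleftrightarrow> (\<forall>x. \<phi> differentiable (at x)) \<and>
     (\<forall>x y. \<phi> x - \<phi> y - grad \<phi> y \<bullet> (x - y) \<le> L / 2 * (norm (x - y))\<^sup>2)"

definition strongly_convex :: "real \<Rightarrow> ('a::real_inner \<Rightarrow> real) \<Rightarrow> bool" where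
  "strongly_convex \<mu> \<phi> \<longleftrightarrow> (\<forall>x. \<phi> differentiable (at x)) \<and>
     (\<forall>x y. \<phi> x - \<phi> y - grad \<phi> y \<bullet> (x - y) \<ge> \<mu> / 2 * (norm (x - y))\<^sup>2)"

definition smoothness_const :: "('a::real_inner \<Rightarrow> real) \<Rightarrow> real" where
  "smoothness_const \<phi> = (LEAST L. smooth L \<phi>)"

definition prox_objective :: "real \<Rightarrow> ('a::real_inner \<Rightarrow> real) \<Rightarrow> 'a \<Rightarrow> 'a \<Rightarrow> real" where
  "prox_objective \<gamma> \<phi> x z = \<phi> z + 1 / (2 * \<gamma>) * (norm (z - x))\<^sup>2"

definition prox :: "real \<Rightarrow> ('a::real_inner \<Rightarrow> real) \<Rightarrow> 'a \<Rightarrow> 'a" where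
  "prox \<gamma> \<phi> x = (ARG_MIN (prox_objective \<gamma> \<phi> x) z. True)"

text \<open>
  For convex \<open>\<phi>\<close> on a Euclidean space and \<open>\<gamma> > 0\<close> the infimum below is attained, namely
  exactly at \<open>prox \<gamma> \<phi> x\<close>, so it is a minimum.
\<close>

definition moreau :: "real \<Rightarrow> ('a::real_inner \<Rightarrow> real) \<Rightarrow> 'a \<Rightarrow> real" where
  "moreau \<gamma> \<phi> x = (INF z. prox_objective \<gamma> \<phi> x z)"

definition avg :: "nat \<Rightarrow> (nat \<Rightarrow> 'a \<Rightarrow> real) \<Rightarrow> 'a \<Rightarrow> real" where
  "avg n f x = 1 / real n * (\<Sum>i=1..n. f i x)"

definition avg_moreau ::
    "real \<Rightarrow> nat \<Rightarrow> (nat \<Rightarrow> 'a::real_inner \<Rightarrow> real) \<Rightarrow> 'a \<Rightarrow> real" where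
  "avg_moreau \<gamma> n f = avg n (\<lambda>i. moreau \<gamma> (f i))"

definition envelope_gap ::
    "real \<Rightarrow> nat \<Rightarrow> (nat \<Rightarrow> 'a::real_inner \<Rightarrow> real) \<Rightarrow> 'a \<Rightarrow> real" where
  "envelope_gap \<gamma> n f x = \<gamma> * avg_moreau \<gamma> n f x - \<gamma> * (INF y. avg_moreau \<gamma> n f y)"

text \<open>
  \<open>p i (Suc k)\<close> stands for the inexact proximal point of \<open>f i\<close> at \<open>x k\<close>; the values \<open>p i 0\<close> are unused.
\<close>

definition inexact_fedexprox ::
    "real \<Rightarrow> real \<Rightarrow> real \<Rightarrow> nat \<Rightarrow> (nat \<Rightarrow> 'a::real_inner \<Rightarrow> real)
      \<Rightarrow> (nat \<Rightarrow> nat \<Rightarrow> 'a) \<Rightarrow> (nat \<Rightarrow> 'a) \<Rightarrow> bool" where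
  "inexact_fedexprox \<gamma> \<alpha> \<epsilon> n f p x \<longleftrightarrow>
     (\<forall>k. \<forall>i\<in>{1..n}. (norm (p i (Suc k) - prox \<gamma> (f i) (x k)))\<^sup>2 \<le> \<epsilon>) \<and>
     (\<forall>k. x (Suc k) = x k + \<alpha> *\<^sub>R ((1 / real n) *\<^sub>R (\<Sum>i=1..n. p i (Suc k)) - x k))"

end

theory Submission
  imports Defs
begin

text \<open>
  Write \<open>M\<close> for the averaged envelope, \<open>z\<close> for the common stationary point and
  \<open>c = \<mu> / (1 + \<gamma> * Lmax)\<close>. Smoothness of \<open>f i\<close> makes its envelope gap at least
  \<open>1 / (1 + \<gamma> * L i)\<close> times the gap of \<open>f i\<close>, so strong convexity of the average gives
  \<open>M\<close> the quadratic growth \<open>M x - M z \<ge> c / 2 * (norm (x - z))\<^sup>2\<close>, which together with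
  convexity of \<open>M\<close> yields the Polyak--Lojasiewicz inequality
  \<open>(norm (grad M x))\<^sup>2 \<ge> c / 2 * (M x - M z)\<close>.
  The iteration is gradient descent on \<open>M\<close> with step \<open>\<alpha> * \<gamma>\<close> and gradient error at most
  \<open>sqrt \<epsilon>1 / \<gamma>\<close>, so the descent lemma contracts the gap up to an additive \<open>\<alpha> * \<epsilon>1 / 2\<close>.
\<close>

section \<open>Gradients\<close>

lemma grad_eqI:
  assumes "GDERIV \<phi> x :> g"
  shows "grad \<phi> x = g"
  unfolding grad_def
proof (rule the_equality[where a = g])
  fix h assume "GDERIV \<phi> x :> h"
  with assms have "(\<lambda>v. v \<bullet> h) = (\<lambda>v. v \<bullet> g)"
    unfolding gderiv_def by (metis has_derivative_unique)
  then have "v \<bullet> (h - g) = 0" for v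
    by (metis inner_diff_right right_minus_eq)
  then show "h = g"
    by (metis inner_eq_zero_iff right_minus_eq)
qed (fact assms)

lemma GDERIV_grad:
  fixes \<phi> :: "'a::euclidean_space \<Rightarrow> real"
  assumes "\<phi> differentiable (at x)"
  shows "GDERIV \<phi> x :> grad \<phi> x"
proof -
  from assms obtain D where D: "(\<phi> has_derivative D) (at x)"
    by (auto simp: differentiable_def)
  then have "linear D"
    by (rule has_derivative_linear)
  \<comment> \<open>Riesz representation: testing \<open>D h\<close> against the scalar 1 moves
    \<open>D\<close> to its adjoint, so the gradient is \<open>adjoint D 1\<close>.\<close>
  then have "D = (\<lambda>h. h \<bullet> adjoint D 1)"
    by (auto simp: adjoint_works)
  with D have "GDERIV \<phi> x :> adjoint D 1"
    by (simp add: gderiv_def)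
  then show ?thesis
    using grad_eqI by metis
qed

lemma GDERIV_minimum_eq_0:
  assumes "GDERIV \<phi> x :> g" and "\<And>y. \<phi> x \<le> \<phi> y"
  shows "g = 0"
proof -
  have "(\<lambda>v. v \<bullet> g) = (\<lambda>v. 0)"
    using assms differential_zero_maxmin[of x UNIV \<phi> "\<lambda>v. v \<bullet> g"]
    by (auto simp: gderiv_def)
  then show ?thesis
    by (metis inner_eq_zero_iff)
qed

text \<open>Along the segment from \<open>x\<close> to \<open>y\<close> this is the one-dimensional
  tangent inequality, with slope given by the chain rule.\<close>

lemma convex_on_GDERIV_above_tangent:
  assumes conv: "convex_on UNIV \<phi>" and g: "GDERIV \<phi> x :> g"
  shows "\<phi> x + g \<bullet> (y - x) \<le> \<phi> y"
proof -
  let ?l = "\<lambda>t::real. x + t *\<^sub>R (y - x)"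
  have "convex_on UNIV (\<lambda>t. \<phi> (?l t))"
  proof (rule convex_onI)
    fix t a b :: real assume "0 < t" "t < 1"
    moreover have "?l ((1 - t) *\<^sub>R a + t *\<^sub>R b) = (1 - t) *\<^sub>R ?l a + t *\<^sub>R ?l b"
      by (simp add: algebra_simps)
    ultimately show "\<phi> (?l ((1 - t) *\<^sub>R a + t *\<^sub>R b)) \<le> (1 - t) * \<phi> (?l a) + t * \<phi> (?l b)"
      using convex_onD[OF conv, of t "?l a" "?l b"] by simp
  qed auto
  moreover have "((\<lambda>t. \<phi> (?l t)) has_real_derivative (y - x) \<bullet> g) (at 0)"
  proof -
    have "(?l has_derivative (\<lambda>h. h *\<^sub>R (y - x))) (at 0)"
      by (auto intro!: derivative_eq_intros)
    moreover have "(\<phi> has_derivative (\<lambda>v. v \<bullet> g)) (at (?l 0))"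
      using g by (simp add: gderiv_def)
    ultimately have "((\<lambda>t. \<phi> (?l t)) has_derivative (\<lambda>h. (h *\<^sub>R (y - x)) \<bullet> g)) (at 0)"
      by (rule has_derivative_compose)
    then show ?thesis
      by (simp add: has_field_derivative_def mult_commute_abs)
  qed
  ultimately have "\<phi> (?l 1) - \<phi> (?l 0) \<ge> (y - x) \<bullet> g * (1 - 0)"
    by (intro convex_on_imp_above_tangent[where A = UNIV]) auto
  then show ?thesis
    by (simp add: inner_commute)
qed

text \<open>The linearization error is squeezed between 0 and a quadratic, so divided by the
  distance it vanishes. This differentiates the envelope without differentiating the proximal
  map.\<close>

lemma GDERIV_quadratic_bounds:
  assumes lower: "\<And>y. 0 \<le> \<phi> y - \<phi> x - g \<bullet> (y - x)"
    and upper: "\<And>y. \<phi> y - \<phi> x - g \<bullet> (y - x) \<le> C * (norm (y - x))\<^sup>2"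
  shows "GDERIV \<phi> x :> g"
  unfolding gderiv_def has_derivative_at_within
proof (intro conjI)
  show "bounded_linear (\<lambda>h. h \<bullet> g)"
    by (rule bounded_linear_inner_left)
  show "((\<lambda>y. (\<phi> y - \<phi> x - (y - x) \<bullet> g) /\<^sub>R norm (y - x)) \<longlongrightarrow> 0) (at x)"
  proof (rule Lim_null_comparison)
    have "norm ((\<phi> y - \<phi> x - (y - x) \<bullet> g) /\<^sub>R norm (y - x)) \<le> C * norm (y - x)" for y
      using lower[of y] upper[of y]
      by (cases "y = x") (auto simp: divide_simps inner_commute power2_eq_square mult_ac)
    then show "\<forall>\<^sub>F y in at x. norm ((\<phi> y - \<phi> x - (y - x) \<bullet> g) /\<^sub>R norm (y - x))
        \<le> C * norm (y - x)"
      by simp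
    show "((\<lambda>y. C * norm (y - x)) \<longlongrightarrow> 0) (at x)"
      by (auto intro!: tendsto_eq_intros)
  qed
qed

text \<open>A gradient step of length \<open>1 / L\<close> lowers \<open>\<phi>\<close> by at least
  the squared gradient norm over \<open>2 * L\<close>, yet cannot go below
  \<open>\<phi> z\<close>.\<close>

lemma smooth_norm_grad_le:
  assumes "smooth L \<phi>" and "L > 0" and min: "\<And>y. \<phi> z \<le> \<phi> y"
  shows "(norm (grad \<phi> x))\<^sup>2 \<le> 2 * L * (\<phi> x - \<phi> z)"
proof -
  define y where "y = x - (1 / L) *\<^sub>R grad \<phi> x"
  have "\<phi> y - \<phi> x - grad \<phi> x \<bullet> (y - x) \<le> L / 2 * (norm (y - x))\<^sup>2"
    using assms(1) by (simp add: smooth_def)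
  moreover have "grad \<phi> x \<bullet> (y - x) = - ((norm (grad \<phi> x))\<^sup>2 / L)"
    by (simp add: y_def power2_norm_eq_inner)
  moreover have "L / 2 * (norm (y - x))\<^sup>2 = (norm (grad \<phi> x))\<^sup>2 / (2 * L)"
    using \<open>L > 0\<close> by (simp add: y_def power_divide power2_eq_square)
  ultimately have "(norm (grad \<phi> x))\<^sup>2 / L - (norm (grad \<phi> x))\<^sup>2 / (2 * L) \<le> \<phi> x - \<phi> z"
    using min[of y] by linarith
  then show ?thesis
    using \<open>L > 0\<close> by (simp add: field_simps)
qed

text \<open>A \<open>LEAST\<close> over the reals is meaningful only if the infimum is attained. It
  is: the smoothness inequality survives passing to the infimum of the admissible constants, and the
  tangent inequality bounds these below by 0.\<close>

lemma smooth_smoothness_const: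
  fixes \<phi> :: "'a::euclidean_space \<Rightarrow> real"
  assumes "smooth C \<phi>"
    and tangent: "\<And>x y. \<phi> y + grad \<phi> y \<bullet> (x - y) \<le> \<phi> x"
  shows "smooth (smoothness_const \<phi>) \<phi>"
proof -
  let ?S = "{L. smooth L \<phi>}"
  have ne: "?S \<noteq> {}"
    using assms(1) by auto
  have "0 \<le> L" if "L \<in> ?S" for L
  proof -
    obtain b :: 'a where "norm b = 1"
      using nonempty_Basis norm_Basis by blast
    moreover from that have "\<phi> b - \<phi> 0 - grad \<phi> 0 \<bullet> (b - 0) \<le> L / 2 * (norm (b - 0))\<^sup>2"
      unfolding smooth_def by blast
    ultimately show ?thesis
      using tangent[of 0 b] by simp
  qed
  then have bdd: "bdd_below ?S"
    by (rule bdd_belowI)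
  have "\<phi> x - \<phi> y - grad \<phi> y \<bullet> (x - y) \<le> Inf ?S / 2 * (norm (x - y))\<^sup>2" for x y
  proof (cases "x = y")
    case False
    \<comment> \<open>Divided by the squared distance, the inequality becomes a lower bound on every
      admissible constant, hence on their infimum.\<close>
    define d where "d = \<phi> x - \<phi> y - grad \<phi> y \<bullet> (x - y)"
    have "2 * d / (norm (x - y))\<^sup>2 \<le> L" if "L \<in> ?S" for L
    proof -
      have "d \<le> L / 2 * (norm (x - y))\<^sup>2"
        using that by (simp add: smooth_def d_def)
      then show ?thesis
        using False by (simp add: pos_divide_le_eq)
    qed
    then have "2 * d / (norm (x - y))\<^sup>2 \<le> Inf ?S"
      by (rule cInf_greatest[OF ne])
    then show ?thesis
      using False by (simp add: pos_divide_le_eq flip: d_def)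
  qed simp
  then have "smooth (Inf ?S) \<phi>"
    using assms(1) by (simp add: smooth_def)
  moreover have "smoothness_const \<phi> = Inf ?S"
    unfolding smoothness_const_def
    using \<open>smooth (Inf ?S) \<phi>\<close> bdd by (intro Least_equality) (auto intro: cInf_lower)
  ultimately show ?thesis
    by simp
qed

text \<open>With \<open>\<eta> * L \<le> 1\<close> the quadratic term has coefficient at most
  \<open>\<eta> / 2\<close>; polarization then turns the inner product of true and inexact gradient
  into squares, leaving no cross term with the error.\<close>

lemma inexact_gradient_descent_step:
  assumes "smooth L \<phi>" and "0 \<le> \<eta>" and "\<eta> * L \<le> 1"
  shows "\<phi> (x - \<eta> *\<^sub>R g)
    \<le> \<phi> x - \<eta> / 2 * (norm (grad \<phi> x))\<^sup>2 + \<eta> / 2 * (norm (g - grad \<phi> x))\<^sup>2"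
proof -
  let ?G = "grad \<phi> x"
  have "\<phi> (x - \<eta> *\<^sub>R g) - \<phi> x - ?G \<bullet> ((x - \<eta> *\<^sub>R g) - x)
      \<le> L / 2 * (norm ((x - \<eta> *\<^sub>R g) - x))\<^sup>2"
    using assms(1) unfolding smooth_def by blast
  then have "\<phi> (x - \<eta> *\<^sub>R g) \<le> \<phi> x - \<eta> * (?G \<bullet> g) + \<eta> / 2 * ((\<eta> * L) * (norm g)\<^sup>2)"
    by (simp add: power_mult_distrib power2_eq_square mult_ac)
  also have "\<dots> \<le> \<phi> x - \<eta> * (?G \<bullet> g) + \<eta> / 2 * (1 * (norm g)\<^sup>2)"
    using assms by (intro add_left_mono mult_left_mono mult_right_mono) auto
  also have "\<dots> = \<phi> x - \<eta> / 2 * (norm ?G)\<^sup>2 + \<eta> / 2 * (norm (g - ?G))\<^sup>2"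
    by (simp add: power2_norm_eq_inner inner_diff_left inner_diff_right inner_commute field_simps)
  finally show ?thesis .
qed

text \<open>Here \<open>\<delta>\<close> stands for a function gap and \<open>g\<close> for a
  gradient. Cauchy-Schwarz bounds \<open>\<delta>\<close> by gradient norm times distance, growth
  bounds the squared distance by \<open>\<delta>\<close>, and one factor \<open>\<delta>\<close>
  cancels.\<close>

lemma quadratic_growth_imp_PL:
  assumes growth: "c / 2 * (norm (x - z))\<^sup>2 \<le> \<delta>" and "\<delta> \<le> g \<bullet> (x - z)" and "0 \<le> \<delta>"
  shows "c / 2 * \<delta> \<le> (norm g)\<^sup>2"
proof (cases "\<delta> = 0")
  case False
  have "\<delta> \<le> norm g * norm (x - z)"
    using assms(2) norm_cauchy_schwarz order_trans by blast
  then have *: "\<delta>\<^sup>2 \<le> (norm g)\<^sup>2 * (norm (x - z))\<^sup>2"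
    using \<open>0 \<le> \<delta>\<close> by (metis power_mono power_mult_distrib)
  show ?thesis
  proof (cases "c \<ge> 0")
    case True
    have "c / 2 * \<delta>\<^sup>2 \<le> (norm g)\<^sup>2 * (c / 2 * (norm (x - z))\<^sup>2)"
      using mult_left_mono[OF *, of "c / 2"] True by (simp add: mult_ac)
    also have "\<dots> \<le> (norm g)\<^sup>2 * \<delta>"
      using growth by (intro mult_left_mono) auto
    finally have "(c / 2 * \<delta>) * \<delta> \<le> (norm g)\<^sup>2 * \<delta>"
      by (simp add: power2_eq_square)
    then show ?thesis
      using False \<open>0 \<le> \<delta>\<close> by simp
  next
    case False
    then show ?thesis
      using \<open>0 \<le> \<delta>\<close> by (intro order_trans[OF mult_nonpos_nonneg]) auto
  qed
qed simp

lemma convex_on_grad_above_tangent: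
  fixes \<phi> :: "'a::euclidean_space \<Rightarrow> real"
  assumes "convex_on UNIV \<phi>" and "\<phi> differentiable (at x)"
  shows "\<phi> x + grad \<phi> x \<bullet> (y - x) \<le> \<phi> y"
  using assms(1) GDERIV_grad[OF assms(2)] by (rule convex_on_GDERIV_above_tangent)

section \<open>The Moreau envelope\<close>

context
  fixes \<phi> :: "'a::euclidean_space \<Rightarrow> real" and \<gamma> :: real
  assumes \<gamma>: "\<gamma> > 0"
    and conv: "convex_on UNIV \<phi>"
    and diff: "\<And>y. \<phi> differentiable (at y)"
    and bdd: "bdd_below (range \<phi>)"
begin

text \<open>\<open>prox\<close> is a choice, so a minimizer has to exist. The lower bound on
  \<open>\<phi>\<close> makes the objective coercive, and compactness of a ball supplies the
  minimizer.\<close>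

lemma prox_minimizes: "prox_objective \<gamma> \<phi> x (prox \<gamma> \<phi> x) \<le> prox_objective \<gamma> \<phi> x y"
proof -
  let ?F = "prox_objective \<gamma> \<phi> x"
  from bdd obtain m where m: "\<And>y. m \<le> \<phi> y"
    by (auto simp: bdd_below_def)
  \<comment> \<open>Outside this radius the quadratic term alone is at least
    \<open>?F x - m\<close>, so no point there beats the center \<open>x\<close>.\<close>
  define R where "R = sqrt (2 * \<gamma> * (?F x - m))"
  have "?F x - m \<ge> 0"
    using m[of x] by (simp add: prox_objective_def)
  then have R2: "R\<^sup>2 = 2 * \<gamma> * (?F x - m)" and "R \<ge> 0"
    using \<gamma> by (simp_all add: R_def)
  have "continuous_on UNIV \<phi>"
    by (intro continuous_at_imp_continuous_on ballI differentiable_imp_continuous_within diff)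
  then have "continuous_on (cball x R) ?F"
    unfolding prox_objective_def
    by (intro continuous_intros) (auto intro: continuous_on_subset)
  then obtain q where q: "q \<in> cball x R" "\<And>y. y \<in> cball x R \<Longrightarrow> ?F q \<le> ?F y"
    using continuous_attains_inf[of "cball x R" ?F] \<open>R \<ge> 0\<close> by auto
  have "?F q \<le> ?F y" for y
  proof (cases "y \<in> cball x R")
    case False
    then have "R\<^sup>2 \<le> (norm (y - x))\<^sup>2"
      using \<open>R \<ge> 0\<close> by (intro power_mono) (auto simp: dist_norm norm_minus_commute)
    then have "?F x - m \<le> 1 / (2 * \<gamma>) * (norm (y - x))\<^sup>2"
      using \<gamma> by (simp add: R2 field_simps)
    then have "?F x \<le> ?F y"
      using m[of y] by (simp add: prox_objective_def)
    moreover have "?F q \<le> ?F x"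
      using q(2)[of x] \<open>R \<ge> 0\<close> by simp
    ultimately show ?thesis
      by simp
  qed (rule q(2))
  then have "is_arg_min ?F (\<lambda>_. True) q"
    by (simp add: is_arg_min_linorder)
  then have "is_arg_min ?F (\<lambda>_. True) (prox \<gamma> \<phi> x)"
    unfolding prox_def arg_min_def by (rule someI)
  then show ?thesis
    by (simp add: is_arg_min_linorder)
qed

lemma moreau_eq: "moreau \<gamma> \<phi> x = prox_objective \<gamma> \<phi> x (prox \<gamma> \<phi> x)"
  unfolding moreau_def by (intro cInf_eq_minimum) (auto intro: prox_minimizes)

lemma moreau_le: "moreau \<gamma> \<phi> x \<le> prox_objective \<gamma> \<phi> x y"
  unfolding moreau_eq by (rule prox_minimizes)

text \<open>First-order optimality of the proximal objective at its minimizer.\<close>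

lemma grad_prox: "grad \<phi> (prox \<gamma> \<phi> x) = (1 / \<gamma>) *\<^sub>R (x - prox \<gamma> \<phi> x)"
proof -
  let ?p = "prox \<gamma> \<phi> x"
  have d\<phi>: "(\<phi> has_derivative (\<lambda>h. h \<bullet> grad \<phi> ?p)) (at ?p)"
    using GDERIV_grad[OF diff] by (simp add: gderiv_def)
  have "((\<lambda>z. \<phi> z + 1 / (2 * \<gamma>) * ((z - x) \<bullet> (z - x))) has_derivative
      (\<lambda>h. h \<bullet> (grad \<phi> ?p + (1 / \<gamma>) *\<^sub>R (?p - x)))) (at ?p)"
    by (rule derivative_eq_intros d\<phi> refl)+
      (use \<gamma> in \<open>simp add: fun_eq_iff inner_commute inner_diff_left inner_diff_right inner_add_right field_simps\<close>)
  then have "GDERIV (prox_objective \<gamma> \<phi> x) ?p :> grad \<phi> ?p + (1 / \<gamma>) *\<^sub>R (?p - x)"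
    by (simp add: gderiv_def prox_objective_def[abs_def] power2_norm_eq_inner)
  then have "grad \<phi> ?p + (1 / \<gamma>) *\<^sub>R (?p - x) = 0"
    using prox_minimizes by (rule GDERIV_minimum_eq_0)
  then have "grad \<phi> ?p = - ((1 / \<gamma>) *\<^sub>R (?p - x))"
    by (rule eq_neg_iff_add_eq_0[THEN iffD2])
  then show ?thesis
    by (simp flip: scaleR_minus_right)
qed

text \<open>The proximal point of \<open>x\<close> is a competitor in the minimization at
  \<open>y\<close>; expanding its squared distance to \<open>y\<close> around \<open>x\<close> gives
  the right-hand side exactly.\<close>

lemma moreau_upper:
  "moreau \<gamma> \<phi> y \<le> moreau \<gamma> \<phi> x + ((1 / \<gamma>) *\<^sub>R (x - prox \<gamma> \<phi> x)) \<bullet> (y - x)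
     + 1 / (2 * \<gamma>) * (norm (y - x))\<^sup>2"
proof -
  have "moreau \<gamma> \<phi> y \<le> prox_objective \<gamma> \<phi> y (prox \<gamma> \<phi> x)"
    by (rule moreau_le)
  also have "\<dots> = moreau \<gamma> \<phi> x + ((1 / \<gamma>) *\<^sub>R (x - prox \<gamma> \<phi> x)) \<bullet> (y - x)
     + 1 / (2 * \<gamma>) * (norm (y - x))\<^sup>2"
    using \<gamma> unfolding moreau_eq prox_objective_def
    by (simp add: power2_norm_eq_inner inner_diff_left inner_diff_right inner_commute field_simps)
  finally show ?thesis .
qed

text \<open>The tangent inequality of \<open>\<phi>\<close> between the two proximal points, with
  the gradient from \<open>grad_prox\<close>, leaves a complete square in the difference of the
  displacements \<open>x - p\<close> and \<open>y - q\<close>, which is dropped. With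
  \<open>moreau_upper\<close> this identifies the gradient of the envelope.\<close>

lemma moreau_lower:
  "moreau \<gamma> \<phi> x + ((1 / \<gamma>) *\<^sub>R (x - prox \<gamma> \<phi> x)) \<bullet> (y - x) \<le> moreau \<gamma> \<phi> y"
proof -
  define p q where "p = prox \<gamma> \<phi> x" and "q = prox \<gamma> \<phi> y"
  have "\<phi> p + ((1 / \<gamma>) *\<^sub>R (x - p)) \<bullet> (q - p) \<le> \<phi> q"
    using convex_on_grad_above_tangent[OF conv diff, of p q] grad_prox[of x] by (simp add: p_def)
  moreover have "((1 / \<gamma>) *\<^sub>R (x - p)) \<bullet> (q - p) + 1 / (2 * \<gamma>) * (norm (q - y))\<^sup>2
      - 1 / (2 * \<gamma>) * (norm (p - x))\<^sup>2
      = ((1 / \<gamma>) *\<^sub>R (x - p)) \<bullet> (y - x) + 1 / (2 * \<gamma>) * (norm ((x - p) - (y - q)))\<^sup>2"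
  proof -
    \<comment> \<open>Naming the coefficient makes the identity polynomial.\<close>
    define a where "a = 1 / (2 * \<gamma>)"
    have "1 / \<gamma> = 2 * a"
      by (simp add: a_def)
    then show ?thesis
      unfolding a_def[symmetric]
      by (simp add: power2_norm_eq_inner inner_diff_left inner_diff_right inner_commute algebra_simps)
  qed
  moreover have "1 / (2 * \<gamma>) * (norm ((x - p) - (y - q)))\<^sup>2 \<ge> 0"
    using \<gamma> by simp
  ultimately show ?thesis
    unfolding moreau_eq prox_objective_def p_def[symmetric] q_def[symmetric] by linarith
qed

lemma moreau_ge_lower_bound:
  assumes "\<And>y. m \<le> \<phi> y"
  shows "m \<le> moreau \<gamma> \<phi> x"
  using assms[of "prox \<gamma> \<phi> x"] \<gamma> by (simp add: moreau_eq prox_objective_def add_increasing2)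

lemma moreau_at_minimum:
  assumes "\<And>y. \<phi> z \<le> \<phi> y"
  shows "moreau \<gamma> \<phi> z = \<phi> z"
proof (rule antisym)
  show "moreau \<gamma> \<phi> z \<le> \<phi> z"
    using moreau_le[of z z] by (simp add: prox_objective_def)
qed (rule moreau_ge_lower_bound[OF assms])

text \<open>Since \<open>x - p\<close> is \<open>\<gamma>\<close> times the gradient at
  \<open>p\<close>, both sides are controlled by \<open>\<phi> p\<close> and the squared gradient
  norm \<open>G\<close>. After cancellation only
  \<open>G \<le> 2 * L * (\<phi> p - \<phi> z)\<close> is left to show, which is
  \<open>smooth_norm_grad_le\<close>.\<close>

lemma moreau_gap_ge:
  assumes sm: "smooth L \<phi>" and "L > 0" and min: "\<And>y. \<phi> z \<le> \<phi> y"
  shows "\<phi> x - \<phi> z \<le> (1 + \<gamma> * L) * (moreau \<gamma> \<phi> x - \<phi> z)"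
proof -
  define p where "p = prox \<gamma> \<phi> x"
  define G where "G = (norm (grad \<phi> p))\<^sup>2"
  have xp: "x - p = \<gamma> *\<^sub>R grad \<phi> p"
    using grad_prox[of x] \<gamma> by (simp add: p_def)
  have "\<phi> x - \<phi> p - grad \<phi> p \<bullet> (x - p) \<le> L / 2 * (norm (x - p))\<^sup>2"
    using sm by (simp add: smooth_def)
  then have 1: "\<phi> x \<le> \<phi> p + \<gamma> * G + L / 2 * (\<gamma>\<^sup>2 * G)"
    by (simp add: xp G_def power2_norm_eq_inner power_mult_distrib)
  have "(norm (p - x))\<^sup>2 = \<gamma>\<^sup>2 * G"
    by (subst norm_minus_commute) (simp add: xp G_def power_mult_distrib)
  then have 2: "moreau \<gamma> \<phi> x = \<phi> p + \<gamma> / 2 * G"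
    using \<gamma> by (simp add: moreau_eq prox_objective_def p_def[symmetric] power2_eq_square)
  have "G \<le> 2 * L * (\<phi> p - \<phi> z)"
    unfolding G_def by (rule smooth_norm_grad_le[OF sm \<open>L > 0\<close> min])
  then have "\<gamma> / 2 * G \<le> \<gamma> / 2 * (2 * L * (\<phi> p - \<phi> z))"
    using \<gamma> by (intro mult_left_mono) auto
  then show ?thesis
    using 1 unfolding 2 by (simp add: field_simps power2_eq_square)
qed

end

theorem theorem1:
  fixes f :: "nat \<Rightarrow> real ^ 'd \<Rightarrow> real" and n :: nat
    and L :: "nat \<Rightarrow> real" and Lmax L\<gamma> \<mu> \<gamma> \<epsilon>1 \<alpha> :: real
    and p :: "nat \<Rightarrow> nat \<Rightarrow> real ^ 'd" and x :: "nat \<Rightarrow> real ^ 'd"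
  assumes n: "n \<ge> 1"
    and diff: "\<And>i y. i \<in> {1..n} \<Longrightarrow> f i differentiable (at y)"
    and bdd: "\<And>i. i \<in> {1..n} \<Longrightarrow> bdd_below (range (f i))"
    and interpolation: "\<exists>z. \<forall>i\<in>{1..n}. grad (f i) z = 0"
    and convex: "\<And>i. i \<in> {1..n} \<Longrightarrow> convex_on UNIV (f i)"
    and L_pos: "\<And>i. i \<in> {1..n} \<Longrightarrow> L i > 0"
    and smooth: "\<And>i. i \<in> {1..n} \<Longrightarrow> smooth (L i) (f i)"
    and Lmax: "Lmax = Max (L ` {1..n})"
    and \<mu>: "\<mu> > 0" and strong: "strongly_convex \<mu> (avg n f)"
    and \<gamma>: "\<gamma> > 0" and \<epsilon>1: "\<epsilon>1 \<ge> 0"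
    and L\<gamma>: "L\<gamma> = smoothness_const (avg_moreau \<gamma> n f)"
    and \<alpha>: "0 < \<alpha>" "\<alpha> \<le> 1 / 4 * (1 / (\<gamma> * L\<gamma>))"
    and iterates: "inexact_fedexprox \<gamma> \<alpha> \<epsilon>1 n f p x"
  shows "(\<forall>K. envelope_gap \<gamma> n f (x K)
            \<le> (1 - \<alpha> * \<gamma> * \<mu> / (8 * (1 + \<gamma> * Lmax))) ^ K * envelope_gap \<gamma> n f (x 0)
              + 4 * \<epsilon>1 * (1 + \<gamma> * Lmax) / \<mu> * (2 * \<alpha> * L\<gamma> + 1 / \<gamma>))
       \<and> (\<alpha> = 1 / 4 * (1 / (\<gamma> * L\<gamma>)) \<longrightarrow>
            (\<forall>xstar. is_arg_min (avg n f) (\<lambda>_. True) xstar \<longrightarrow>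
              (\<forall>K. (norm (x K - xstar))\<^sup>2
                \<le> (1 - \<mu> / (32 * L\<gamma> * (1 + \<gamma> * Lmax))) ^ K
                    * (L\<gamma> * (1 + \<gamma> * Lmax) / \<mu>) * (norm (x 0 - xstar))\<^sup>2
                  + 12 * \<epsilon>1 * ((1 / \<gamma> + Lmax) / \<mu>)\<^sup>2)))"
proof -

  \<comment> \<open>Common minimizer and positivity of the constants\<close>
  let ?M = "avg_moreau \<gamma> n f"
  from interpolation obtain z where z: "\<And>i. i \<in> {1..n} \<Longrightarrow> grad (f i) z = 0"
    by blast
  have zmin: "f i z \<le> f i y" if "i \<in> {1..n}" for i y
    using convex_on_grad_above_tangent[OF convex[OF that] diff[OF that], of z y] z[OF that] by simp
  have n0: "real n > 0"
    using n by simp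
  have avg_mono: "avg n g y \<le> avg n h w" if "\<And>i. i \<in> {1..n} \<Longrightarrow> g i y \<le> h i w"
    for g h :: "nat \<Rightarrow> real ^ 'd \<Rightarrow> real" and y w
    unfolding avg_def using that by (intro mult_left_mono sum_mono) auto
  have L_le: "L i \<le> Lmax" if "i \<in> {1..n}" for i
    unfolding Lmax using that by (intro Max_ge) auto
  have "Lmax > 0"
    using L_le[of 1] L_pos[of 1] n by simp
  then have Q: "1 + \<gamma> * Lmax > 0"
    using \<gamma> by (simp add: add_pos_pos)
  define c where "c = \<mu> / (1 + \<gamma> * Lmax)"
  have c_pos: "c > 0"
    unfolding c_def using Q \<mu> by simp
  \<comment> \<open>The step-size range forces this: for \<open>L\<gamma> \<le> 0\<close> its upper
    end is nonpositive, division by zero being 0, which contradicts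
    \<open>\<alpha> > 0\<close>.\<close>
  have L\<gamma>_pos: "L\<gamma> > 0"
  proof (rule ccontr)
    assume "\<not> L\<gamma> > 0"
    then have "1 / 4 * (1 / (\<gamma> * L\<gamma>)) \<le> 0"
      using \<gamma> by (simp add: divide_nonneg_nonpos mult_nonneg_nonpos)
    with \<alpha> show False by linarith
  qed

  \<comment> \<open>Gradient and smoothness of the averaged envelope\<close>
  define P where "P y = (1 / real n) *\<^sub>R (\<Sum>i=1..n. prox \<gamma> (f i) y)" for y
  \<comment> \<open>The candidate gradient of \<open>?M\<close>: the average of the gradients of the
    individual envelopes.\<close>
  define G where "G y = (1 / \<gamma>) *\<^sub>R (y - P y)" for y
  have G_sum: "G y \<bullet> v = 1 / real n * (\<Sum>i=1..n. ((1 / \<gamma>) *\<^sub>R (y - prox \<gamma> (f i) y)) \<bullet> v)" for y v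
  proof -
    have "(\<Sum>i=1..n. (1 / \<gamma>) *\<^sub>R (y - prox \<gamma> (f i) y))
        = (1 / \<gamma>) *\<^sub>R (real n *\<^sub>R y - (\<Sum>i=1..n. prox \<gamma> (f i) y))"
      unfolding scaleR_sum_right[symmetric] sum_subtractf sum_constant_scaleR by simp
    then have "G y = (1 / real n) *\<^sub>R (\<Sum>i=1..n. (1 / \<gamma>) *\<^sub>R (y - prox \<gamma> (f i) y))"
      using n0 by (simp add: G_def P_def scaleR_diff_right)
    then show ?thesis
      by (simp add: inner_sum_left)
  qed
  have M_lower: "?M y + G y \<bullet> (w - y) \<le> ?M w" for y w
  proof -
    have "(\<Sum>i=1..n. moreau \<gamma> (f i) y + ((1 / \<gamma>) *\<^sub>R (y - prox \<gamma> (f i) y)) \<bullet> (w - y))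
        \<le> (\<Sum>i=1..n. moreau \<gamma> (f i) w)"
      by (intro sum_mono moreau_lower \<gamma> convex diff bdd)
    then show ?thesis
      using n0 unfolding avg_moreau_def avg_def G_sum sum.distrib
      by (simp add: divide_right_mono flip: add_divide_distrib)
  qed
  have M_upper: "?M w \<le> ?M y + G y \<bullet> (w - y) + 1 / (2 * \<gamma>) * (norm (w - y))\<^sup>2" for y w
  proof -
    have "(\<Sum>i=1..n. moreau \<gamma> (f i) w)
        \<le> (\<Sum>i=1..n. moreau \<gamma> (f i) y + ((1 / \<gamma>) *\<^sub>R (y - prox \<gamma> (f i) y)) \<bullet> (w - y)
            + 1 / (2 * \<gamma>) * (norm (w - y))\<^sup>2)"
      by (intro sum_mono moreau_upper \<gamma> convex diff bdd)
    then have "1 / real n * (\<Sum>i=1..n. moreau \<gamma> (f i) w)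
        \<le> 1 / real n * (\<Sum>i=1..n. moreau \<gamma> (f i) y + ((1 / \<gamma>) *\<^sub>R (y - prox \<gamma> (f i) y)) \<bullet> (w - y)
            + 1 / (2 * \<gamma>) * (norm (w - y))\<^sup>2)"
      by (intro mult_left_mono) auto
    also have "\<dots> = ?M y + G y \<bullet> (w - y) + 1 / (2 * \<gamma>) * (norm (w - y))\<^sup>2"
      using n0 unfolding avg_moreau_def avg_def G_sum sum.distrib distrib_left by simp
    finally show ?thesis
      by (simp add: avg_moreau_def avg_def)
  qed
  have M_GDERIV: "GDERIV ?M y :> G y" for y
  proof (rule GDERIV_quadratic_bounds)
    show "0 \<le> ?M w - ?M y - G y \<bullet> (w - y)" for w
      using M_lower[of y w] by simp
    show "?M w - ?M y - G y \<bullet> (w - y) \<le> 1 / (2 * \<gamma>) * (norm (w - y))\<^sup>2" for w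
      using M_upper[of w y] by simp
  qed
  have M_grad: "grad ?M y = G y" for y
    using M_GDERIV by (rule grad_eqI)
  \<comment> \<open>This constant witnesses that some admissible constant exists, so that the least
    one, \<open>L\<gamma>\<close>, is itself admissible.\<close>
  have "Defs.smooth (1 / \<gamma>) ?M"
    unfolding smooth_def M_grad
  proof (intro conjI allI)
    show "?M differentiable (at y)" for y
      using M_GDERIV by (auto simp: gderiv_def differentiable_def)
    show "?M w - ?M y - G y \<bullet> (w - y) \<le> 1 / \<gamma> / 2 * (norm (w - y))\<^sup>2" for w y
      using M_upper[of w y] by (simp add: mult.commute)
  qed
  then have M_smooth: "Defs.smooth L\<gamma> ?M"
    unfolding L\<gamma> using M_lower by (intro smooth_smoothness_const) (auto simp: M_grad)

  \<comment> \<open>Minimum of the averaged envelope\<close>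
  have moreau_ge: "f i z \<le> moreau \<gamma> (f i) y" if "i \<in> {1..n}" for i y
    using that by (intro moreau_ge_lower_bound \<gamma> convex diff bdd zmin)
  have moreau_z: "moreau \<gamma> (f i) z = f i z" if "i \<in> {1..n}" for i
    using that by (intro moreau_at_minimum \<gamma> convex diff bdd zmin)
  have M_z: "?M z = avg n f z"
    by (simp add: avg_moreau_def avg_def moreau_z)
  have M_min: "?M z \<le> ?M y" for y
    unfolding avg_moreau_def
  proof (rule avg_mono)
    fix i assume i: "i \<in> {1..n}"
    show "moreau \<gamma> (f i) z \<le> moreau \<gamma> (f i) y"
      unfolding moreau_z[OF i] by (rule moreau_ge[OF i])
  qed
  have "(INF y. ?M y) = ?M z"
    by (intro cInf_eq_minimum) (auto intro: M_min)
  then have gap: "envelope_gap \<gamma> n f y = \<gamma> * (?M y - ?M z)" for y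
    by (simp add: envelope_gap_def right_diff_distrib)

  \<comment> \<open>Quadratic growth, quadratic upper bound and the Polyak--Lojasiewicz
    inequality\<close>
  have f_min: "avg n f z \<le> avg n f y" for y
    by (intro avg_mono zmin)
  have "avg n f differentiable (at z)"
    using strong by (simp add: strongly_convex_def)
  then have "grad (avg n f) z = 0"
    by (rule GDERIV_minimum_eq_0[OF GDERIV_grad]) (rule f_min)
  then have f_growth: "\<mu> / 2 * (norm (y - z))\<^sup>2 \<le> avg n f y - avg n f z" for y
    using strong by (metis strongly_convex_def diff_zero inner_zero_left)
  have gap_growth: "c / 2 * (norm (y - z))\<^sup>2 \<le> ?M y - ?M z" for y
  proof -
    have "f i y - f i z \<le> (1 + \<gamma> * Lmax) * (moreau \<gamma> (f i) y - f i z)" if i: "i \<in> {1..n}" for i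
    proof -
      have "f i y - f i z \<le> (1 + \<gamma> * L i) * (moreau \<gamma> (f i) y - f i z)"
        using i by (intro moreau_gap_ge \<gamma> convex diff bdd smooth L_pos zmin)
      also have "\<dots> \<le> (1 + \<gamma> * Lmax) * (moreau \<gamma> (f i) y - f i z)"
      proof (rule mult_right_mono)
        show "0 \<le> moreau \<gamma> (f i) y - f i z"
          using moreau_ge[OF i] by simp
      qed (use L_le[OF i] \<gamma> in simp)
      finally show ?thesis .
    qed
    then have "(\<Sum>i=1..n. f i y - f i z) \<le> (\<Sum>i=1..n. (1 + \<gamma> * Lmax) * (moreau \<gamma> (f i) y - f i z))"
      by (rule sum_mono)
    then have "1 / real n * (\<Sum>i=1..n. f i y - f i z)
        \<le> 1 / real n * ((1 + \<gamma> * Lmax) * (\<Sum>i=1..n. moreau \<gamma> (f i) y - f i z))"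
      unfolding sum_distrib_left[symmetric] by (intro mult_left_mono) auto
    then have "avg n f y - avg n f z \<le> (1 + \<gamma> * Lmax) * (?M y - ?M z)"
      unfolding M_z by (simp add: avg_moreau_def avg_def sum_subtractf diff_divide_distrib right_diff_distrib)
    then have "\<mu> / 2 * (norm (y - z))\<^sup>2 \<le> (1 + \<gamma> * Lmax) * (?M y - ?M z)"
      using f_growth[of y] by linarith
    then show ?thesis
      using Q by (simp add: c_def field_simps)
  qed
  have gap_upper: "?M y - ?M z \<le> L\<gamma> / 2 * (norm (y - z))\<^sup>2" for y
  proof -
    have "G z = 0"
      using M_GDERIV M_min by (rule GDERIV_minimum_eq_0)
    then show ?thesis
      using M_smooth unfolding smooth_def M_grad by (metis diff_zero inner_zero_left)
  qed
  \<comment> \<open>The tangent of \<open>?M\<close> at \<open>y\<close>, evaluated at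
    \<open>z\<close>, bounds the gap by the inner product of \<open>G y\<close> with
    \<open>y - z\<close>.\<close>
  have PL: "c / 2 * (?M y - ?M z) \<le> (norm (G y))\<^sup>2" for y
    using M_lower[of y z] M_min[of y]
    by (intro quadratic_growth_imp_PL[where x = y and z = z] gap_growth)
      (auto simp: inner_diff_right)

  \<comment> \<open>Contraction factor\<close>
  have step: "(\<alpha> * \<gamma>) * L\<gamma> \<le> 1 / 4"
    using \<alpha>(2) \<gamma> L\<gamma>_pos by (simp add: field_simps)
  \<comment> \<open>This is half of \<open>\<alpha> * \<gamma> * c / 4\<close>, the decrease rate
    that the descent step and \<open>PL\<close> give together.\<close>
  define \<rho> where "\<rho> = \<alpha> * \<gamma> * \<mu> / (8 * (1 + \<gamma> * Lmax))"
  have \<rho>: "\<rho> = \<alpha> * \<gamma> * c / 8"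
    by (simp add: \<rho>_def c_def)
  have \<rho>_pos: "\<rho> > 0"
    unfolding \<rho> using \<alpha>(1) \<gamma> c_pos by simp
  \<comment> \<open>At distance 1 from \<open>z\<close> the lower and upper quadratic bounds give
    \<open>c \<le> L\<gamma>\<close>, and \<open>step\<close> bounds
    \<open>\<alpha> * \<gamma> * L\<gamma>\<close>. Nonnegativity of \<open>1 - \<rho>\<close> is
    used when the recursion is iterated.\<close>
  have "\<rho> \<le> 1"
  proof -
    obtain b :: "real ^ 'd" where "norm b = 1"
      using nonempty_Basis norm_Basis by blast
    then have "c \<le> L\<gamma>"
      using gap_growth[of "z + b"] gap_upper[of "z + b"] by simp
    then have "(\<alpha> * \<gamma>) * c \<le> (\<alpha> * \<gamma>) * L\<gamma>"
      using \<alpha> \<gamma> by (intro mult_left_mono) auto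
    with step show ?thesis
      unfolding \<rho> by linarith
  qed

  \<comment> \<open>One-step recursion and its iteration\<close>
  let ?E = "\<lambda>k. envelope_gap \<gamma> n f (x k)"
  have E_nonneg: "?E k \<ge> 0" for k
    using \<gamma> M_min by (simp add: gap)
  have rec: "?E (Suc k) \<le> (1 - \<rho>) * ?E k + \<alpha> * \<epsilon>1 / 2" for k
  proof -
    \<comment> \<open>\<open>e\<close> is the averaged proximal error. It perturbs the gradient by
      \<open>e\<close> divided by \<open>\<gamma>\<close>, so the update is an exact step along the
      inexact gradient \<open>g\<close>.\<close>
    define e where "e = (1 / real n) *\<^sub>R (\<Sum>i=1..n. p i (Suc k) - prox \<gamma> (f i) (x k))"
    define g where "g = G (x k) - (1 / \<gamma>) *\<^sub>R e"
    have "norm (\<Sum>i=1..n. p i (Suc k) - prox \<gamma> (f i) (x k)) \<le> (\<Sum>i=1..n. sqrt \<epsilon>1)"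
      using iterates unfolding inexact_fedexprox_def
      by (intro sum_norm_le real_le_rsqrt) auto
    then have "norm e \<le> sqrt \<epsilon>1"
      using n0 by (simp add: e_def field_simps)
    then have e: "(norm e)\<^sup>2 \<le> \<epsilon>1"
      using \<epsilon>1 by (metis norm_ge_zero power_mono real_sqrt_pow2)
    have "x (Suc k) = x k - (\<alpha> * \<gamma>) *\<^sub>R g"
    proof -
      have "x (Suc k) = x k + \<alpha> *\<^sub>R ((1 / real n) *\<^sub>R (\<Sum>i=1..n. p i (Suc k)) - x k)"
        using iterates by (simp add: inexact_fedexprox_def)
      also have "(1 / real n) *\<^sub>R (\<Sum>i=1..n. p i (Suc k)) = P (x k) + e"
        by (simp add: P_def e_def sum_subtractf scaleR_diff_right)
      also have "x k + \<alpha> *\<^sub>R (P (x k) + e - x k) = x k - (\<alpha> * \<gamma>) *\<^sub>R g"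
        using \<gamma> by (simp add: g_def G_def algebra_simps)
      finally show ?thesis .
    qed
    then have "?M (x (Suc k)) \<le> ?M (x k) - (\<alpha> * \<gamma>) / 2 * (norm (G (x k)))\<^sup>2
        + (\<alpha> * \<gamma>) / 2 * (norm (g - G (x k)))\<^sup>2"
      using inexact_gradient_descent_step[OF M_smooth, of "\<alpha> * \<gamma>" "x k" g] step \<alpha> \<gamma>
      by (simp add: M_grad)
    moreover have "(\<alpha> * \<gamma>) / 2 * (c / 2 * (?M (x k) - ?M z)) \<le> (\<alpha> * \<gamma>) / 2 * (norm (G (x k)))\<^sup>2"
      using \<alpha> \<gamma> by (intro mult_left_mono PL) auto
    moreover have "(norm (g - G (x k)))\<^sup>2 = (norm e)\<^sup>2 / \<gamma>\<^sup>2"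
      using \<gamma> by (simp add: g_def power_divide)
    then have "(\<alpha> * \<gamma>) / 2 * (norm (g - G (x k)))\<^sup>2 \<le> (\<alpha> * \<gamma>) / 2 * (\<epsilon>1 / \<gamma>\<^sup>2)"
      using \<alpha> \<gamma> e by (intro mult_left_mono) (auto simp: divide_right_mono)
    moreover have "(\<alpha> * \<gamma>) / 2 * (c / 2 * (?M (x k) - ?M z)) = 2 * \<rho> * (?M (x k) - ?M z)"
      by (simp add: \<rho>)
    ultimately have "?M (x (Suc k)) - ?M z
        \<le> (1 - 2 * \<rho>) * (?M (x k) - ?M z) + (\<alpha> * \<gamma>) / 2 * (\<epsilon>1 / \<gamma>\<^sup>2)"
      unfolding left_diff_distrib mult_1 by linarith
    then have "?E (Suc k) \<le> \<gamma> * ((1 - 2 * \<rho>) * (?M (x k) - ?M z) + (\<alpha> * \<gamma>) / 2 * (\<epsilon>1 / \<gamma>\<^sup>2))"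
      unfolding gap using \<gamma> by (intro mult_left_mono) auto
    also have "\<dots> = (1 - 2 * \<rho>) * ?E k + \<alpha> * \<epsilon>1 / 2"
      unfolding gap using \<gamma> by (simp add: distrib_left power2_eq_square mult_ac)
    also have "\<dots> \<le> (1 - \<rho>) * ?E k + \<alpha> * \<epsilon>1 / 2"
      using \<rho>_pos E_nonneg[of k] by (intro add_right_mono mult_right_mono) auto
    finally show ?thesis .
  qed
  define B where "B = 4 * \<epsilon>1 * (1 + \<gamma> * Lmax) / \<mu> * (2 * \<alpha> * L\<gamma> + 1 / \<gamma>)"
  \<comment> \<open>The summand \<open>1 / \<gamma>\<close> of the last factor of \<open>B\<close>
    contributes exactly \<open>\<alpha> * \<epsilon>1 / 2\<close> to \<open>\<rho> * B\<close>.
    Hence \<open>(1 - \<rho>) * B\<close> plus the per-step error stays at most \<open>B\<close>,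
    which closes the induction.\<close>
  have "4 * \<epsilon>1 * (1 + \<gamma> * Lmax) / \<mu> * (1 / \<gamma>) \<le> B"
    unfolding B_def using \<epsilon>1 Q \<mu> \<alpha> L\<gamma>_pos by (intro mult_left_mono) auto
  then have "\<rho> * (4 * \<epsilon>1 * (1 + \<gamma> * Lmax) / \<mu> * (1 / \<gamma>)) \<le> \<rho> * B"
    using \<rho>_pos by (intro mult_left_mono) auto
  moreover have "\<rho> * (4 * \<epsilon>1 * (1 + \<gamma> * Lmax) / \<mu> * (1 / \<gamma>)) = \<alpha> * \<epsilon>1 / 2"
    unfolding \<rho>_def using Q \<mu> \<gamma> by (simp add: divide_simps)
  ultimately have B: "\<alpha> * \<epsilon>1 / 2 \<le> \<rho> * B"
    by simp
  have main: "?E K \<le> (1 - \<rho>) ^ K * ?E 0 + B" for K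
  proof (induction K)
    case 0
    have "B \<ge> 0"
      unfolding B_def using \<epsilon>1 Q \<mu> \<alpha> L\<gamma>_pos \<gamma> by (intro mult_nonneg_nonneg) auto
    then show ?case by simp
  next
    case (Suc K)
    have "(1 - \<rho>) * ?E K \<le> (1 - \<rho>) * ((1 - \<rho>) ^ K * ?E 0 + B)"
      using \<open>\<rho> \<le> 1\<close> by (intro mult_left_mono Suc.IH) auto
    then show ?case
      using rec[of K] B by (simp add: algebra_simps)
  qed

  \<comment> \<open>Distance to the minimizer at the largest step size\<close>
  have "(norm (x K - w))\<^sup>2
      \<le> (1 - \<mu> / (32 * L\<gamma> * (1 + \<gamma> * Lmax))) ^ K * (L\<gamma> * (1 + \<gamma> * Lmax) / \<mu>) * (norm (x 0 - w))\<^sup>2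
        + 12 * \<epsilon>1 * ((1 / \<gamma> + Lmax) / \<mu>)\<^sup>2"
    if \<alpha>_eq: "\<alpha> = 1 / 4 * (1 / (\<gamma> * L\<gamma>))" and w: "is_arg_min (avg n f) (\<lambda>_. True) w" for w K
  proof -
    \<comment> \<open>Strong convexity makes the minimizer of the average unique, so it is
      \<open>z\<close>.\<close>
    have "avg n f w \<le> avg n f z"
      using w by (simp add: is_arg_min_linorder)
    then have "\<mu> / 2 * (norm (w - z))\<^sup>2 \<le> 0"
      using f_growth[of w] by linarith
    then have "w = z"
      using \<mu> by (simp add: mult_le_0_iff)
    have \<rho>_eq: "\<mu> / (32 * L\<gamma> * (1 + \<gamma> * Lmax)) = \<rho>"
      unfolding \<rho>_def \<alpha>_eq using \<gamma> by simp
    have "2 * \<alpha> * L\<gamma> + 1 / \<gamma> = 3 / (2 * \<gamma>)"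
      unfolding \<alpha>_eq using \<gamma> L\<gamma>_pos by (simp add: field_simps)
    then have B_eq: "B = 6 * \<epsilon>1 * (1 + \<gamma> * Lmax) / (\<mu> * \<gamma>)"
      unfolding B_def by (simp add: mult.commute mult.assoc)
    \<comment> \<open>Growth bounds the gap at \<open>x K\<close> below and smoothness bounds the
      gap at \<open>x 0\<close> above; the quotient \<open>L\<gamma> / c\<close> is the factor
      before the initial distance.\<close>
    have "\<gamma> * (c / 2 * (norm (x K - z))\<^sup>2) \<le> ?E K"
      unfolding gap using \<gamma> by (intro mult_left_mono gap_growth) auto
    also have "\<dots> \<le> (1 - \<rho>) ^ K * ?E 0 + B"
      by (rule main)
    also have "\<dots> \<le> (1 - \<rho>) ^ K * (\<gamma> * (L\<gamma> / 2 * (norm (x 0 - z))\<^sup>2)) + B"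
      unfolding gap using \<gamma> \<open>\<rho> \<le> 1\<close> by (intro add_right_mono mult_left_mono gap_upper) auto
    finally have "2 / (\<gamma> * c) * (\<gamma> * (c / 2 * (norm (x K - z))\<^sup>2))
        \<le> 2 / (\<gamma> * c) * ((1 - \<rho>) ^ K * (\<gamma> * (L\<gamma> / 2 * (norm (x 0 - z))\<^sup>2)) + B)"
      using \<gamma> c_pos by (intro mult_left_mono) auto
    moreover have "2 / (\<gamma> * c) * (\<gamma> * (c / 2 * (norm (x K - z))\<^sup>2)) = (norm (x K - z))\<^sup>2"
      using \<gamma> c_pos by simp
    moreover have "2 / (\<gamma> * c) * ((1 - \<rho>) ^ K * (\<gamma> * (L\<gamma> / 2 * (norm (x 0 - z))\<^sup>2)))
        = (1 - \<rho>) ^ K * (L\<gamma> * (1 + \<gamma> * Lmax) / \<mu>) * (norm (x 0 - z))\<^sup>2"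
      using \<gamma> \<mu> by (simp add: c_def field_simps)
    moreover have "2 / (\<gamma> * c) * B = 12 * \<epsilon>1 * ((1 / \<gamma> + Lmax) / \<mu>)\<^sup>2"
    proof -
      have "1 / \<gamma> + Lmax = (1 + \<gamma> * Lmax) / \<gamma>"
        using \<gamma> by (simp add: field_simps)
      then show ?thesis
        unfolding B_eq c_def using \<gamma> \<mu> by (simp add: power2_eq_square field_simps)
    qed
    ultimately show ?thesis
      unfolding \<rho>_eq \<open>w = z\<close> distrib_left[of "2 / (\<gamma> * c)"] by linarith
  qed
  then show ?thesis
    using main unfolding \<rho>_def B_def by blast
qed

end
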